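(* For every metrizable space $X$ the following conditions are equivalent: (1) for every metrizable space $Y$ with more than one point, $t(Q_p(X,Y))=\omega$; (2) there are a metrizable space $Y$ with more than one point and a function $f\in Q_p(X,Y)$ such that $t(f,Q_p(X,Y))=\omega$; (3) there is a function $f\in Q_p(X,\mathbb{R})$ such that $t(f,Q_p(X,\mathbb{R}))=\omega$; (4) $X$ is $\mathcal{K}_\Omega$-Lindelöf.
   Context: A function $f:X\to Y$ between topological spaces is quasicontinuous if for every $x\in X$, every open $V\ni f(x)$ and every open $U\ni x$ there is a nonempty open $W\subseteq U$ with $f(W)\subseteq V$. $Q(X,Y)$ is the set of all quasicontinuous functions $X\to Y$, and $Q_p(X,Y)$ is $Q(X,Y)$ with the topology of pointwise convergence (the subspace topology from the product $Y^X$). A space $Z$ has countable tightness at a point $z\in Z$, written $t(z,Z)=\omega$, if whenever $A\subseteq Z$ and $z\in\overline{A}$, there is a countable $B\subseteq A$ with $z\in\overline{B}$. $Z$ has countable tightness, written $t(Z)=\omega$, if $t(z,Z)=\omega$ for every $z\in Z$. (Thus "$=\omega$" here just means "is countable".) For a space $X$, $\mathcal{K}_\Omega$ denotes the collection of all families $\mathcal{U}$ of open subsets of $X$ such that $X=\bigcup\{\overline{U}:U\in\mathcal{U}\}$, no element of $\mathcal{U}$ is dense in $X$, and for each finite $F\subseteq X$ there is $U\in\mathcal{U}$ with $F\subseteq\overline{U}$. The space $X$ is $\mathcal{K}_\Omega$-Lindelöf if every $\mathcal{U}\in\mathcal{K}_\Omega$ has a countable subfamily that belongs to $\mathcal{K}_\Omega$.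 *)

theory Defs
  imports "HOL-Analysis.Analysis"
begin

definition quasicontinuous_map :: "'a topology \<Rightarrow> 'b topology \<Rightarrow> ('a \<Rightarrow> 'b) \<Rightarrow> bool" where
  "quasicontinuous_map X Y f \<longleftrightarrow>
     f \<in> topspace X \<rightarrow> topspace Y \<and>
     (\<forall>x \<in> topspace X. \<forall>V U. openin Y V \<and> f x \<in> V \<and> openin X U \<and> x \<in> U \<longrightarrow>
        (\<exists>W. openin X W \<and> W \<noteq> {} \<and> W \<subseteq> U \<and> f ` W \<subseteq> V))"

text \<open>
  Functions on the carrier of \<open>X\<close> are represented by extensional functions, so that equality
  of functions is equality on the carrier. The product topology already lives on the
  extensional functions.
\<close>
definition Qp :: "'a topology \<Rightarrow> 'b topology \<Rightarrow> ('a \<Rightarrow> 'b) topology" where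
  "Qp X Y = subtopology (product_topology (\<lambda>_. Y) (topspace X))
     {f \<in> extensional (topspace X). quasicontinuous_map X Y f}"

definition countable_tightness_at :: "'a \<Rightarrow> 'a topology \<Rightarrow> bool" where
  "countable_tightness_at z Z \<longleftrightarrow>
     (\<forall>A \<subseteq> topspace Z. z \<in> Z closure_of A \<longrightarrow>
        (\<exists>B \<subseteq> A. countable B \<and> z \<in> Z closure_of B))"

definition countable_tightness :: "'a topology \<Rightarrow> bool" where
  "countable_tightness Z \<longleftrightarrow> (\<forall>z \<in> topspace Z. countable_tightness_at z Z)"

definition K_Omega :: "'a topology \<Rightarrow> 'a set set set" where
  "K_Omega X = {\<U>. (\<forall>U \<in> \<U>. openin X U) \<and>
     topspace X = (\<Union>U \<in> \<U>. X closure_of U) \<and>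
     (\<forall>U \<in> \<U>. X closure_of U \<noteq> topspace X) \<and>
     (\<forall>F. finite F \<and> F \<subseteq> topspace X \<longrightarrow> (\<exists>U \<in> \<U>. F \<subseteq> X closure_of U))}"

definition K_Omega_Lindelof :: "'a topology \<Rightarrow> bool" where
  "K_Omega_Lindelof X \<longleftrightarrow>
     (\<forall>\<U> \<in> K_Omega X. \<exists>\<V> \<subseteq> \<U>. countable \<V> \<and> \<V> \<in> K_Omega X)"

text \<open>The class of spaces over which \<open>Y\<close> ranges, restricted to carriers inside the type \<open>'b\<close>.\<close>
definition nontrivial_metrizable :: "'b topology \<Rightarrow> bool" where
  "nontrivial_metrizable Y \<longleftrightarrow>
     metrizable_space Y \<and> (\<exists>u \<in> topspace Y. \<exists>v \<in> topspace Y. u \<noteq> v)"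

text \<open>
  A HOL formula cannot quantify over all types, so ``for every'' and ``there is'' a metrizable
  space \<open>Y\<close> are rendered by quantifying over all topologies on subsets of arbitrary types \<open>'b\<close>
  and \<open>'c\<close>, which stay free type variables of the theorem. Such a quantifier ranges over at least
  one space with more than one point exactly when the type has two distinct elements, and this
  has to be assumed: over a one-element type the universal condition holds vacuously and the
  existential one fails.
\<close>

end

theory Submission
  imports Defs
begin

text \<open>
  Say that an open set \<open>U\<close> captures a finite set \<open>F\<close> if \<open>F\<close> lies in the closure of \<open>U\<close>.

  Countable tightness at a single function \<open>f\<close> already forces \<open>X\<close> to be \<open>K_Omega\<close>-Lindelof,
  for every metrizable target with more than one point. There is a quasicontinuous \<open>h\<close> with two values whose distance from \<open>f\<close> is
  bounded below (\<open>quasicontinuous_map_far_from\<close>). If \<open>U\<close> captures \<open>F\<close>, then \<open>h\<close> can be changed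
  inside the closure of \<open>U\<close> so that it agrees with \<open>f\<close> on \<open>F\<close>
  (\<open>quasicontinuous_map_prescribed_values\<close>). The functions so obtained from a family in
  \<open>K_Omega X\<close> accumulate at \<open>f\<close>, and such a function is close to \<open>f\<close> on \<open>F\<close> only if its \<open>U\<close>
  captures \<open>F\<close>; so countably many functions accumulating at \<open>f\<close> name a countable subfamily.

  For the converse the difficulty is that two quasicontinuous functions \<open>f\<close> and \<open>g\<close> that are
  close at a point \<open>x\<close> need not be close on any open set near \<open>x\<close>, and that closeness on an open
  set says nothing about the frontier points of this set. Both defects occur on small
  sets. The first one disappears where the oscillation of \<open>f\<close> is small, that is, off a closed
  nowhere dense set; the second one is confined to frontiers of open sets. In a metrizable
  \<open>K_Omega\<close>-Lindelof space every closed nowhere dense set is countable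
  (\<open>countable_nowhere_dense_if_K_Omega_Lindelof\<close>), and closed sets may be removed without losing the
  Lindelof property (\<open>countable_subfamily_off_closed\<close>). So all exceptional points can be collected,
  by a countable closing-off process, in one countable set \<open>D\<close>, and closeness on each of the
  countably many finite subsets of \<open>D\<close> is imposed by hand
  (\<open>countable_subset_close_on_finite_sets\<close>). Fixing the precision before the exceptional set is
  essential: the set of all discontinuities of \<open>f\<close> may be dense, while the points of large
  oscillation form a closed set.

  With the two implications the equivalences follow, since every nontrivial target admits a
  constant function and every type with two elements carries a discrete, hence metrizable, topology.
\<close>

section \<open>Quasicontinuous maps and pointwise convergence\<close>

lemma in_topspace_Qp:
  "f \<in> topspace (Qp X Y) \<longleftrightarrow> f \<in> extensional (topspace X) \<and> quasicontinuous_map X Y f"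
  unfolding Qp_def by (auto simp: quasicontinuous_map_def PiE_def)

lemma quasicontinuous_mapE:
  assumes "quasicontinuous_map X Y f" "openin X U" "x \<in> U" "openin Y V" "f x \<in> V"
  obtains W where "openin X W" "W \<noteq> {}" "W \<subseteq> U" "f ` W \<subseteq> V"
proof -
  have "x \<in> topspace X"
    using assms(2,3) openin_subset by blast
  then show ?thesis
    using assms that unfolding quasicontinuous_map_def by blast
qed

lemma quasicontinuous_map_cong:
  assumes "quasicontinuous_map X Y g" "\<And>x. x \<in> topspace X \<Longrightarrow> g x = h x"
  shows "quasicontinuous_map X Y h"
  unfolding quasicontinuous_map_def
proof (intro conjI ballI allI impI)
  show "h \<in> topspace X \<rightarrow> topspace Y"
  proof
    fix x
    assume x: "x \<in> topspace X"
    then have "g x \<in> topspace Y"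
      using assms(1) by (auto simp: quasicontinuous_map_def)
    then show "h x \<in> topspace Y"
      using assms(2)[OF x] by simp
  qed
  fix x V U
  assume x: "x \<in> topspace X" and UV: "openin Y V \<and> h x \<in> V \<and> openin X U \<and> x \<in> U"
  then have UV': "openin X U" "x \<in> U" "openin Y V" "g x \<in> V"
    using assms(2) by auto
  obtain W where W: "openin X W" "W \<noteq> {}" "W \<subseteq> U" "g ` W \<subseteq> V"
    using quasicontinuous_mapE[OF assms(1) UV'] .
  then have "h ` W \<subseteq> V"
    using assms(2) openin_subset[OF W(1)] by (force simp: image_subset_iff subset_iff)
  with W show "\<exists>W. openin X W \<and> W \<noteq> {} \<and> W \<subseteq> U \<and> h ` W \<subseteq> V"
    by blast
qed

lemma constant_in_topspace_Qp:
  assumes "y \<in> topspace Y"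
  shows "restrict (\<lambda>_. y) (topspace X) \<in> topspace (Qp X Y)"
proof -
  have "quasicontinuous_map X Y (\<lambda>_. y)"
    using assms unfolding quasicontinuous_map_def by (intro conjI ballI allI impI) auto
  then have "quasicontinuous_map X Y (restrict (\<lambda>_. y) (topspace X))"
    by (rule quasicontinuous_map_cong) simp
  then show ?thesis
    by (simp add: in_topspace_Qp)
qed

text \<open>
  The basic neighbourhoods in the topology of pointwise convergence, written with the metric
  of the target. All later arguments about closures in \<open>Qp\<close> go through this criterion.
\<close>

lemma (in Metric_space) in_closure_of_Qp:
  fixes X :: "'b topology"
  assumes "A \<subseteq> topspace (Qp X mtopology)"
  shows "f \<in> Qp X mtopology closure_of A \<longleftrightarrow>
    f \<in> topspace (Qp X mtopology) \<and>
    (\<forall>F e. finite F \<and> F \<subseteq> topspace X \<and> e > 0 \<longrightarrow> (\<exists>g\<in>A. \<forall>x\<in>F. d (f x) (g x) < e))"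
    (is "?L \<longleftrightarrow> ?R")
proof
  assume L: ?L
  then have f: "f \<in> topspace (Qp X mtopology)"
    by (simp add: in_closure_of)
  then have fM: "f x \<in> M" if "x \<in> topspace X" for x
    using that by (auto simp: in_topspace_Qp quasicontinuous_map_def)
  have "\<exists>g\<in>A. \<forall>x\<in>F. d (f x) (g x) < e"
    if F: "finite F" "F \<subseteq> topspace X" and e: "e > 0" for F e
  proof -
    define P where "P = (\<Pi>\<^sub>E x\<in>topspace X. if x \<in> F then mball (f x) e else M)"
    define S where "S = {f \<in> extensional (topspace X). quasicontinuous_map X mtopology f}"
    have "openin (product_topology (\<lambda>_. mtopology) (topspace X)) P"
      unfolding P_def openin_PiE_gen
      using F by (auto intro!: disjI2 finite_subset[OF _ F(1)])
    then have "openin (Qp X mtopology) (P \<inter> S)"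
      unfolding Qp_def S_def by (rule openin_subtopology_Int)
    moreover have "f \<in> P \<inter> S"
      using f fM e by (auto simp: P_def S_def in_topspace_Qp PiE_def)
    ultimately obtain g where g: "g \<in> A" "g \<in> P"
      using L unfolding in_closure_of by blast
    have "d (f x) (g x) < e" if "x \<in> F" for x
    proof -
      have "g x \<in> (if x \<in> F then mball (f x) e else M)"
        using g(2) F(2) that unfolding P_def by (blast intro: PiE_mem)
      then show ?thesis
        using that by simp
    qed
    with g show ?thesis
      by blast
  qed
  with f show ?R
    by blast
next
  assume R: ?R
  then have f: "f \<in> topspace (Qp X mtopology)"
    by blast
  have "\<exists>g\<in>A. g \<in> T" if T: "f \<in> T" "openin (Qp X mtopology) T" for T
  proof -
    obtain O' where O': "openin (product_topology (\<lambda>_. mtopology) (topspace X)) O'"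
      and TO: "T = O' \<inter> {f \<in> extensional (topspace X). quasicontinuous_map X mtopology f}"
      using T(2) unfolding Qp_def openin_subtopology by blast
    have "f \<in> O'"
      using T(1) TO by blast
    have "\<exists>U. finite {i \<in> topspace X. U i \<noteq> topspace mtopology} \<and>
        (\<forall>i\<in>topspace X. openin mtopology (U i)) \<and>
        f \<in> Pi\<^sub>E (topspace X) U \<and> Pi\<^sub>E (topspace X) U \<subseteq> O'"
      using bspec[OF O'[unfolded openin_product_topology_alt] \<open>f \<in> O'\<close>] .
    then obtain U where finU: "finite {i \<in> topspace X. U i \<noteq> topspace mtopology}"
      and U: "\<And>i. i \<in> topspace X \<Longrightarrow> openin mtopology (U i)"
      and fU: "f \<in> Pi\<^sub>E (topspace X) U" and UO: "Pi\<^sub>E (topspace X) U \<subseteq> O'"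
      by (elim exE conjE) simp
    define F where "F = {i \<in> topspace X. U i \<noteq> topspace mtopology}"
    have "\<exists>r>0. mball (f i) r \<subseteq> U i" if "i \<in> F" for i
    proof -
      have "i \<in> topspace X"
        using that by (simp add: F_def)
      then show ?thesis
        using U[of i] PiE_mem[OF fU] unfolding openin_mtopology by blast
    qed
    then obtain r where r: "\<And>i. i \<in> F \<Longrightarrow> r i > 0 \<and> mball (f i) (r i) \<subseteq> U i"
      by metis
    define e where "e = Min (insert 1 (r ` F))"
    have finF: "finite F"
      using finU by (simp add: F_def)
    then have "e > 0"
      using r by (auto simp: e_def)
    moreover have "F \<subseteq> topspace X"
      by (auto simp: F_def)
    ultimately obtain g where g: "g \<in> A" "\<And>x. x \<in> F \<Longrightarrow> d (f x) (g x) < e"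
      using R[THEN conjunct2, rule_format, of F e] finF by auto
    have gQ: "g \<in> extensional (topspace X)" "quasicontinuous_map X mtopology g"
      using g(1) assms by (auto simp: in_topspace_Qp)
    have "g i \<in> U i" if i: "i \<in> topspace X" for i
    proof (cases "i \<in> F")
      case True
      then have "e \<le> r i"
        using finF by (simp add: e_def)
      moreover have "f i \<in> M" "g i \<in> M"
        using f gQ i by (auto simp: in_topspace_Qp quasicontinuous_map_def)
      ultimately have "g i \<in> mball (f i) (r i)"
        using g(2)[OF True] by simp
      then show ?thesis
        using r[OF True] by blast
    next
      case False
      then have "U i = M"
        using i by (simp add: F_def)
      then show ?thesis
        using gQ i by (auto simp: quasicontinuous_map_def)
    qed
    then have "g \<in> T"
      using gQ UO by (auto simp: TO PiE_def)
    with g(1) show ?thesis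
      by blast
  qed
  with f show ?L
    by (auto simp: in_closure_of)
qed

section \<open>Open families whose closures capture finite sets\<close>

lemma
  assumes "\<U> \<in> K_Omega X"
  shows K_Omega_openin: "U \<in> \<U> \<Longrightarrow> openin X U"
    and K_Omega_not_dense: "U \<in> \<U> \<Longrightarrow> X closure_of U \<noteq> topspace X"
    and K_Omega_finite_subset:
      "finite F \<Longrightarrow> F \<subseteq> topspace X \<Longrightarrow> \<exists>U\<in>\<U>. F \<subseteq> X closure_of U"
proof -
  note K = assms[unfolded K_Omega_def mem_Collect_eq]
  show "U \<in> \<U> \<Longrightarrow> openin X U"
    by (rule K[THEN conjunct1, rule_format])
  show "U \<in> \<U> \<Longrightarrow> X closure_of U \<noteq> topspace X"
    by (rule K[THEN conjunct2, THEN conjunct2, THEN conjunct1, rule_format])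
  show "finite F \<Longrightarrow> F \<subseteq> topspace X \<Longrightarrow> \<exists>U\<in>\<U>. F \<subseteq> X closure_of U"
    using K[THEN conjunct2, THEN conjunct2, THEN conjunct2, rule_format] by simp
qed

text \<open>
  The condition that the closures cover the space is the case of one-point sets of the
  condition on finite sets.
\<close>

lemma K_OmegaI:
  assumes "\<And>U. U \<in> \<U> \<Longrightarrow> openin X U" "\<And>U. U \<in> \<U> \<Longrightarrow> X closure_of U \<noteq> topspace X"
    and cover: "\<And>F. finite F \<Longrightarrow> F \<subseteq> topspace X \<Longrightarrow> \<exists>U\<in>\<U>. F \<subseteq> X closure_of U"
  shows "\<U> \<in> K_Omega X"
proof -
  have "\<exists>U\<in>\<U>. x \<in> X closure_of U" if "x \<in> topspace X" for x
    using cover[of "{x}"] that by simp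
  then have "topspace X = (\<Union>U\<in>\<U>. X closure_of U)"
    using closure_of_subset_topspace[of X] by blast
  then show ?thesis
    using assms by (simp add: K_Omega_def)
qed

text \<open>
  The \<open>K_Omega\<close>-Lindelof property without the condition that no member is dense: a single dense
  member already captures every finite set by itself. The indexed form keeps track of which
  function a chosen open set comes from.
\<close>

lemma countable_subfamily_if_K_Omega_Lindelof:
  assumes L: "K_Omega_Lindelof X"
    and W: "\<And>i. i \<in> I \<Longrightarrow> openin X (W i)"
    and cover: "\<And>F. finite F \<Longrightarrow> F \<subseteq> topspace X \<Longrightarrow> \<exists>i\<in>I. F \<subseteq> X closure_of W i"
  shows "\<exists>J\<subseteq>I. countable J \<and>
    (\<forall>F. finite F \<and> F \<subseteq> topspace X \<longrightarrow> (\<exists>i\<in>J. F \<subseteq> X closure_of W i))"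
proof (cases "\<exists>i\<in>I. X closure_of W i = topspace X")
  case True
  then obtain i where "i \<in> I" "X closure_of W i = topspace X"
    by blast
  then show ?thesis
    by (intro exI[of _ "{i}"]) auto
next
  case False
  have "W ` I \<in> K_Omega X"
    using False W cover by (intro K_OmegaI) auto
  then obtain \<V> where \<V>: "\<V> \<subseteq> W ` I" "countable \<V>" "\<V> \<in> K_Omega X"
    using L unfolding K_Omega_Lindelof_def by blast
  then obtain J where J: "J \<subseteq> I" "countable J" "\<V> = W ` J"
    using countable_subset_image[of \<V> W I] by blast
  have "\<exists>i\<in>J. F \<subseteq> X closure_of W i" if "finite F" "F \<subseteq> topspace X" for F
    using K_Omega_finite_subset[OF \<V>(3) that] unfolding J(3) by auto
  with J show ?thesis
    by (intro exI[of _ J]) simp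
qed

section \<open>Countable tightness at one function\<close>

text \<open>
  Where \<open>f\<close> is close to \<open>a\<close> the function \<open>h\<close> should be \<open>b\<close>, and where it is not, \<open>a\<close>. For this
  the space is split into two disjoint open sets \<open>R\<close> and \<open>Q\<close> and a common frontier; quasicontinuity
  of \<open>f\<close> carries the bounds on its distance from \<open>a\<close> over to all of \<open>R\<close> and \<open>Q\<close>. A point of the
  frontier lies in both closures, so a two-valued function may take either value there and
  stay quasicontinuous; one that is far from the value of \<open>f\<close> is taken.
\<close>

lemma (in Metric_space) quasicontinuous_map_far_from:
  fixes X :: "'b topology"
  assumes f: "quasicontinuous_map X mtopology f"
    and ab: "a \<in> M" "b \<in> M" "a \<noteq> b"
  obtains h c where "quasicontinuous_map X mtopology h" "c > 0"
    "\<And>x. x \<in> topspace X \<Longrightarrow> d (f x) (h x) \<ge> c"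
proof -
  define c where "c = d a b / 2"
  have c: "c > 0"
    using ab by (simp add: c_def)
  have fM: "f x \<in> M" if "x \<in> topspace X" for x
    using that f by (auto simp: quasicontinuous_map_def)
  have far: "d y b \<ge> c" if "d y a \<le> c" "y \<in> M" for y
    using triangle[of a y b] that ab by (simp add: c_def commute)
  define P where "P = X interior_of {x \<in> topspace X. d (f x) a < c}"
  \<comment> \<open>regular open, so that a point outside \<open>R\<close> is in the closure of \<open>Q\<close>\<close>
  define R where "R = X interior_of (X closure_of P)"
  define Q where "Q = topspace X - X closure_of P"
  define h where "h x = (if x \<in> R then b else if x \<in> Q then a
     else if d (f x) a \<le> c then b else a)" for x
  have PR: "P \<subseteq> R"
    unfolding R_def P_def by (simp add: closure_of_subset interior_of_subset_topspace interior_of_maximal)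
  have P: "d (f x) a < c" if "x \<in> P" for x
    using that interior_of_subset[of X] by (force simp: P_def)
  have openQ: "openin X Q" and openR: "openin X R" and openP: "openin X P"
    by (auto simp: Q_def R_def P_def)
  have R_near: "d (f x) a \<le> c" if "x \<in> R" for x
  proof (rule ccontr)
    assume "\<not> d (f x) a \<le> c"
    define e where "e = d (f x) a - c"
    have e: "e > 0"
      using \<open>\<not> d (f x) a \<le> c\<close> by (simp add: e_def)
    have xX: "x \<in> topspace X"
      using that openR openin_subset by blast
    obtain W where W: "openin X W" "W \<noteq> {}" "W \<subseteq> R" "f ` W \<subseteq> mball (f x) e"
      using quasicontinuous_mapE[OF f openR \<open>x \<in> R\<close> openin_mball[of "f x" e]] e fM[OF xX] by auto
    have "W \<subseteq> X closure_of P"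
      using W(3) interior_of_subset by (force simp: R_def)
    then obtain w where w: "w \<in> W" "w \<in> P"
      using W(1,2) openin_Int_closure_of_eq_empty[of X W P] by blast
    then have "d (f x) (f w) < e" "f w \<in> M"
      using W(4) by auto
    then show False
      using triangle[of "f x" "f w" a] P[OF w(2)] fM[OF xX] ab by (simp add: e_def)
  qed
  have Q_far: "d (f x) a \<ge> c" if "x \<in> Q" for x
  proof (rule ccontr)
    assume less: "\<not> d (f x) a \<ge> c"
    have xX: "x \<in> topspace X"
      using that by (simp add: Q_def)
    obtain W where W: "openin X W" "W \<noteq> {}" "W \<subseteq> Q" "f ` W \<subseteq> mball a c"
      using quasicontinuous_mapE[OF f openQ \<open>x \<in> Q\<close> openin_mball[of a c]] less fM[OF xX] ab
      by (auto simp: commute)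
    have "W \<subseteq> P"
      unfolding P_def using W openin_subset[OF W(1)]
      by (intro interior_of_maximal) (auto simp: commute)
    then show False
      using W(2,3) PR openin_subset[OF openP] closure_of_subset[of P X] by (auto simp: Q_def)
  qed
  have hM: "h x \<in> M" for x
    using ab by (simp add: h_def)
  have hR: "h ` R \<subseteq> {b}"
    by (auto simp: h_def)
  have "R \<inter> Q = {}"
    using interior_of_subset[of X "X closure_of P"] by (auto simp: R_def Q_def)
  then have hQ: "h ` Q \<subseteq> {a}"
    by (auto simp: h_def)
  have near: "\<exists>W. openin X W \<and> W \<noteq> {} \<and> W \<subseteq> U \<and> h ` W \<subseteq> {h x}"
    if x: "x \<in> topspace X" and U: "openin X U" "x \<in> U" for x U
  proof -
    have "x \<in> X closure_of R" if "x \<notin> Q"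
      using that x closure_of_mono[OF PR] by (auto simp: Q_def)
    moreover have "x \<in> X closure_of Q" if "x \<notin> R"
    proof -
      have "R = topspace X - X closure_of (topspace X - X closure_of P)"
        by (simp add: R_def interior_of_closure_of)
      then show ?thesis
        using that x by (auto simp: Q_def)
    qed
    moreover have "(x \<notin> Q \<and> h x = b) \<or> (x \<notin> R \<and> h x = a)"
      using \<open>R \<inter> Q = {}\<close> by (auto simp: h_def)
    ultimately consider "x \<in> X closure_of R" "h x = b" | "x \<in> X closure_of Q" "h x = a"
      by blast
    then show ?thesis
    proof cases
      case 1
      then have "U \<inter> R \<noteq> {}"
        using U by (metis disjoint_iff in_closure_of)
      then show ?thesis
        using 1 hR U openR by (intro exI[of _ "U \<inter> R"]) auto
    next
      case 2
      then have "U \<inter> Q \<noteq> {}"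
        using U by (metis disjoint_iff in_closure_of)
      then show ?thesis
        using 2 hQ U openQ by (intro exI[of _ "U \<inter> Q"]) auto
    qed
  qed
  have "quasicontinuous_map X mtopology h"
    unfolding quasicontinuous_map_def
  proof (intro conjI ballI allI impI)
    show "h \<in> topspace X \<rightarrow> topspace mtopology"
      using hM by simp
    fix x V U
    assume "x \<in> topspace X" "openin mtopology V \<and> h x \<in> V \<and> openin X U \<and> x \<in> U"
    then obtain W where "openin X W" "W \<noteq> {}" "W \<subseteq> U" "h ` W \<subseteq> {h x}" "h x \<in> V"
      using near[of x U] by auto
    then show "\<exists>W. openin X W \<and> W \<noteq> {} \<and> W \<subseteq> U \<and> h ` W \<subseteq> V"
      by (intro exI[of _ W]) auto
  qed
  moreover have "d (f x) (h x) \<ge> c" if "x \<in> topspace X" for x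
    using far[OF _ fM[OF that]] R_near[of x] Q_far[of x] by (auto simp: h_def)
  ultimately show ?thesis
    using that c by blast
qed

lemma (in Metric_space) finite_set_disjoint_mcballs:
  assumes "finite F" "F \<subseteq> M"
  obtains r where "r > 0" "\<And>x y. x \<in> F \<Longrightarrow> y \<in> F \<Longrightarrow> x \<noteq> y \<Longrightarrow> mcball x r \<inter> mcball y r = {}"
proof -
  define D where "D = (\<lambda>(x, y). d x y) ` {p \<in> F \<times> F. fst p \<noteq> snd p}"
  \<comment> \<open>the \<open>1\<close> covers the case that \<open>F\<close> has at most one point\<close>
  define r where "r = Min (insert 1 D) / 3"
  have fin: "finite D"
    using assms by (auto simp: D_def)
  have pos: "r > 0"
    using fin assms by (auto simp: r_def D_def subset_iff)
  have "mcball x r \<inter> mcball y r = {}" if "x \<in> F" "y \<in> F" "x \<noteq> y" for x y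
  proof (rule ccontr)
    assume "mcball x r \<inter> mcball y r \<noteq> {}"
    then obtain z where z: "x \<in> M" "y \<in> M" "z \<in> M" "d x z \<le> r" "d y z \<le> r"
      by auto
    have "d x y \<in> D"
      using that by (force simp: D_def)
    then have "3 * r \<le> d x y"
      using fin by (simp add: r_def)
    then show False
      using z triangle[of x z y] pos by (simp add: commute)
  qed
  with pos that show ?thesis
    by blast
qed

text \<open>
  A constant value on the closure of an open set keeps quasicontinuity at all points of that
  closure. So \<open>h\<close> is overwritten by the constants \<open>v x\<close> on the closures of disjoint pieces of
  \<open>U\<close> near the finitely many points \<open>x\<close>; outside these closures, on an open set, \<open>h\<close> is kept.
\<close>

lemma (in Metric_space) quasicontinuous_map_prescribed_values:
  assumes h: "quasicontinuous_map mtopology Y h"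
    and U: "openin mtopology U"
    and F: "finite F" "F \<subseteq> mtopology closure_of U"
    and v: "\<And>x. x \<in> F \<Longrightarrow> v x \<in> topspace Y"
  obtains g where "quasicontinuous_map mtopology Y g" "\<And>x. x \<in> F \<Longrightarrow> g x = v x"
    "\<And>z. z \<in> M - mtopology closure_of U \<Longrightarrow> g z = h z"
proof -
  have FM: "F \<subseteq> M"
    using F(2) closure_of_subset_topspace[of mtopology U] by auto
  then obtain r where r: "r > 0"
    "\<And>x y. x \<in> F \<Longrightarrow> y \<in> F \<Longrightarrow> x \<noteq> y \<Longrightarrow> mcball x r \<inter> mcball y r = {}"
    using finite_set_disjoint_mcballs[OF F(1)] by metis
  define C where "C x = mtopology closure_of (U \<inter> mball x r)" for x
  define g where "g z = (if z \<in> (\<Union>x\<in>F. C x) then v (THE x. x \<in> F \<and> z \<in> C x) else h z)" for z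
  have C_ball: "C x \<subseteq> mcball x r" for x
    unfolding C_def by (intro closure_of_minimal) auto
  have C_U: "C x \<subseteq> mtopology closure_of U" for x
    unfolding C_def by (intro closure_of_mono) auto
  have xC: "x \<in> C x" if "x \<in> F" for x
    unfolding C_def in_closure_of
  proof (intro conjI allI impI)
    show "x \<in> topspace mtopology"
      using that FM by auto
    fix T
    assume "x \<in> T \<and> openin mtopology T"
    then have "openin mtopology (T \<inter> mball x r)" "x \<in> T \<inter> mball x r"
      using that FM r(1) by auto
    moreover have "x \<in> mtopology closure_of U"
      using F(2) that by blast
    ultimately obtain y where "y \<in> U" "y \<in> T \<inter> mball x r"
      unfolding in_closure_of by meson
    then show "\<exists>y. y \<in> U \<inter> mball x r \<and> y \<in> T"
      by blast
  qed
  have gC: "g z = v x" if "x \<in> F" "z \<in> C x" for x z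
  proof -
    have unique: "y = x" if "y \<in> F" "z \<in> C y" for y
    proof (rule ccontr)
      assume "y \<noteq> x"
      then have "mcball y r \<inter> mcball x r = {}"
        using r(2) \<open>x \<in> F\<close> that by simp
      moreover have "z \<in> mcball x r" "z \<in> mcball y r"
        using C_ball \<open>z \<in> C x\<close> that by blast+
      ultimately show False
        by blast
    qed
    have "(THE x. x \<in> F \<and> z \<in> C x) = x"
      using that unique by (intro the_equality) blast+
    moreover have "z \<in> (\<Union>x\<in>F. C x)"
      using that by blast
    ultimately show ?thesis
      unfolding g_def by simp
  qed
  have gh: "g z = h z" if "z \<notin> (\<Union>x\<in>F. C x)" for z
    using that by (simp add: g_def)
  have hY: "h z \<in> topspace Y" if "z \<in> M" for z
    using h that by (auto simp: quasicontinuous_map_def)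
  have "quasicontinuous_map mtopology Y g"
    unfolding quasicontinuous_map_def
  proof (intro conjI ballI allI impI)
    show "g \<in> topspace mtopology \<rightarrow> topspace Y"
    proof
      fix z assume "z \<in> topspace mtopology"
      then show "g z \<in> topspace Y"
        using gC[of _ z] gh[of z] hY[of z] v by (cases "z \<in> (\<Union>x\<in>F. C x)") auto
    qed
    fix z V S
    assume z: "z \<in> topspace mtopology"
      and VS: "openin Y V \<and> g z \<in> V \<and> openin mtopology S \<and> z \<in> S"
    show "\<exists>W. openin mtopology W \<and> W \<noteq> {} \<and> W \<subseteq> S \<and> g ` W \<subseteq> V"
    proof (cases "z \<in> (\<Union>x\<in>F. C x)")
      case True
      then obtain x where x: "x \<in> F" "z \<in> C x"
        by blast
      define W where "W = S \<inter> (U \<inter> mball x r)"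
      have "openin mtopology W"
        unfolding W_def using VS U by (intro openin_Int) auto
      moreover have "W \<noteq> {}"
        using VS x(2) unfolding W_def C_def in_closure_of by blast
      moreover have "W \<subseteq> C x"
        unfolding W_def C_def using closure_of_subset[of "U \<inter> mball x r" mtopology] openin_subset[OF U]
        by auto
      then have "g ` W \<subseteq> V"
        using gC[OF x(1)] x VS by auto
      ultimately show ?thesis
        using W_def by blast
    next
      case False
      have "closedin mtopology (\<Union>x\<in>F. C x)"
        using F(1) by (intro closedin_Union) (auto simp: C_def)
      then have "openin mtopology (S - (\<Union>x\<in>F. C x))"
        using VS by (intro openin_diff) auto
      moreover have "z \<in> S - (\<Union>x\<in>F. C x)" "openin Y V" "h z \<in> V"
        using False VS gh[OF False] by auto
      ultimately obtain W where W: "openin mtopology W" "W \<noteq> {}" "W \<subseteq> S - (\<Union>x\<in>F. C x)" "h ` W \<subseteq> V"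
        using quasicontinuous_mapE[OF h] by blast
      then have "g ` W \<subseteq> V"
        using gh by (force simp: image_subset_iff)
      with W show ?thesis
        by blast
    qed
  qed
  moreover have "g x = v x" if "x \<in> F" for x
    using gC xC that by blast
  moreover have "g z = h z" if "z \<in> M - mtopology closure_of U" for z
    using that C_U by (intro gh) blast
  ultimately show ?thesis
    using that by blast
qed

text \<open>
  Given a family \<open>\<U>\<close>, let \<open>A\<close> consist of the functions that are uniformly far from \<open>f\<close> outside
  the closure of some member of \<open>\<U>\<close>. Members that capture \<open>F\<close> yield functions in \<open>A\<close> equal to
  \<open>f\<close> on \<open>F\<close>, hence \<open>f\<close> is in the closure of \<open>A\<close>. Conversely a function in \<open>A\<close> that is close
  to \<open>f\<close> on \<open>F\<close> can only come from a member whose closure contains \<open>F\<close>, so a countable subset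
  of \<open>A\<close> with \<open>f\<close> in its closure gives a countable subfamily.
\<close>

theorem K_Omega_Lindelof_if_countable_tightness_at:
  assumes X: "metrizable_space X" and Y: "nontrivial_metrizable Y"
    and f: "f \<in> topspace (Qp X Y)" and tight: "countable_tightness_at f (Qp X Y)"
  shows "K_Omega_Lindelof X"
  unfolding K_Omega_Lindelof_def
proof
  fix \<U>
  assume \<U>: "\<U> \<in> K_Omega X"
  obtain M d where "Metric_space M d" and XM: "X = Metric_space.mtopology M d"
    using X unfolding metrizable_space_def by blast
  then interpret X: Metric_space M d
    by simp
  obtain N e where "Metric_space N e" and YN: "Y = Metric_space.mtopology N e"
    using Y unfolding nontrivial_metrizable_def metrizable_space_def by blast
  then interpret Y: Metric_space N e
    by simp
  obtain a b where ab: "a \<in> N" "b \<in> N" "a \<noteq> b"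
    using Y by (auto simp: nontrivial_metrizable_def YN)
  have qf: "quasicontinuous_map X Y.mtopology f"
    using f by (simp add: in_topspace_Qp YN)
  obtain h c where h: "quasicontinuous_map X Y.mtopology h" and c: "c > 0"
    and far: "\<And>x. x \<in> topspace X \<Longrightarrow> e (f x) (h x) \<ge> c"
    using Y.quasicontinuous_map_far_from[OF qf ab] by blast
  define A where "A = {g \<in> topspace (Qp X Y). \<exists>U\<in>\<U>. \<forall>z\<in>topspace X - X closure_of U. e (f z) (g z) \<ge> c}"
  have A: "A \<subseteq> topspace (Qp X Y)"
    by (auto simp: A_def)
  have "f \<in> Qp X Y closure_of A"
  proof -
    have "\<exists>g\<in>A. \<forall>x\<in>F. e (f x) (g x) < \<epsilon>"
      if F: "finite F" "F \<subseteq> topspace X" and \<epsilon>: "\<epsilon> > 0" for F \<epsilon>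
    proof -
      obtain U where U: "U \<in> \<U>" "F \<subseteq> X closure_of U"
        using K_Omega_finite_subset[OF \<U> F] by blast
      have "openin X U"
        using K_Omega_openin[OF \<U> U(1)] .
      moreover have fN: "f x \<in> N" if "x \<in> F" for x
        using that F(2) qf by (auto simp: quasicontinuous_map_def)
      ultimately obtain g where g: "quasicontinuous_map X Y.mtopology g" "\<And>x. x \<in> F \<Longrightarrow> g x = f x"
        "\<And>z. z \<in> topspace X - X closure_of U \<Longrightarrow> g z = h z"
        using X.quasicontinuous_map_prescribed_values[of Y.mtopology h U F f] h F(1) U(2)
        unfolding XM by auto
      define g' where "g' = restrict g (topspace X)"
      have "quasicontinuous_map X Y.mtopology g'"
        using g(1) by (rule quasicontinuous_map_cong) (simp add: g'_def)
      then have "g' \<in> A"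
        using g(3) far U(1) by (auto simp: A_def in_topspace_Qp YN g'_def intro!: bexI[of _ U])
      moreover have "e (f x) (g' x) < \<epsilon>" if "x \<in> F" for x
        using that g(2) F(2) fN \<epsilon> by (auto simp: g'_def)
      ultimately show ?thesis
        by blast
    qed
    then show ?thesis
      using f A Y.in_closure_of_Qp[of A X f] unfolding YN by blast
  qed
  then obtain B where B: "B \<subseteq> A" "countable B" "f \<in> Qp X Y closure_of B"
    using tight A unfolding countable_tightness_at_def by blast
  obtain u where u: "\<And>g. g \<in> B \<Longrightarrow> u g \<in> \<U> \<and> (\<forall>z\<in>topspace X - X closure_of u g. e (f z) (g z) \<ge> c)"
    using B(1) unfolding A_def by (simp add: subset_iff) metis
  have cover: "\<exists>g\<in>B. F \<subseteq> X closure_of u g" if F: "finite F" "F \<subseteq> topspace X" for F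
  proof -
    have "B \<subseteq> topspace (Qp X Y.mtopology)"
      using B(1) A by (auto simp: YN)
    then obtain g where g: "g \<in> B" "\<forall>x\<in>F. e (f x) (g x) < c"
      using B(3) F c Y.in_closure_of_Qp[of B X f] unfolding YN by blast
    then have "F \<subseteq> X closure_of u g"
      using u[OF g(1)] F(2) by (meson DiffI linorder_not_less subset_iff)
    with g(1) show ?thesis
      by blast
  qed
  have "u ` B \<in> K_Omega X"
  proof (rule K_OmegaI)
    fix U
    assume "U \<in> u ` B"
    then have "U \<in> \<U>"
      using u by blast
    then show "openin X U" "X closure_of U \<noteq> topspace X"
      using K_Omega_openin[OF \<U>] K_Omega_not_dense[OF \<U>] by blast+
  qed (use cover in auto)
  then show "\<exists>\<V>\<subseteq>\<U>. countable \<V> \<and> \<V> \<in> K_Omega X"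
    using u B(2) by (intro exI[of _ "u ` B"]) auto
qed

section \<open>Metrizable spaces in which countable subfamilies capture finite sets\<close>

text \<open>
  Balls that shrink towards \<open>x\<close>, whose closed versions all miss \<open>N\<close>: off \<open>x\<close> only finitely many
  of them matter, so their union has no other limit point in \<open>N\<close>.
\<close>

lemma (in Metric_space) open_set_touching_at_one_point:
  assumes N: "closedin mtopology N" and x: "x \<in> mtopology closure_of (M - N)"
  obtains U where "openin mtopology U" "x \<in> mtopology closure_of U" "mtopology closure_of U \<inter> N \<subseteq> {x}"
proof -
  have xM: "x \<in> M"
    using x by (simp add: metric_closure_of)
  have "\<exists>z s. z \<in> M - N \<and> s > 0 \<and> s \<le> inverse (real (Suc n)) \<and> d x z < inverse (real (Suc n)) \<and> mcball z s \<inter> N = {}" for n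
  proof -
    obtain z where z: "z \<in> M - N" "d x z < inverse (real (Suc n))"
    proof -
      have "\<exists>z\<in>M - N. z \<in> mball x (inverse (real (Suc n)))"
        using x unfolding metric_closure_of by (simp del: in_mball)
      then show ?thesis
        using that by auto
    qed
    obtain r where r: "r > 0" "mcball z r \<subseteq> M - N"
      using z(1) N unfolding closedin_def openin_mtopology_mcball topspace_mtopology by blast
    define s where "s = min r (inverse (real (Suc n)))"
    have "mcball z s \<subseteq> mcball z r"
      by (auto simp: s_def)
    then show ?thesis
      using z r by (intro exI[of _ z] exI[of _ s]) (auto simp: s_def)
  qed
  then obtain z s where z: "\<And>n. z n \<in> M - N" and s: "\<And>n::nat. s n > 0" "\<And>n. s n \<le> inverse (real (Suc n))"
    and dz: "\<And>n. d x (z n) < inverse (real (Suc n))" and zN: "\<And>n. mcball (z n) (s n) \<inter> N = {}"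
    by metis
  define U where "U = (\<Union>n. mball (z n) (s n))"
  have "openin mtopology U"
    unfolding U_def by blast
  moreover have "x \<in> mtopology closure_of U"
    unfolding metric_closure_of
  proof (intro CollectI conjI allI impI)
    show "x \<in> M"
      by (fact xM)
    fix r :: real
    assume "r > 0"
    then obtain n where "inverse (real (Suc n)) < r"
      using reals_Archimedean by blast
    then have "z n \<in> mball x r"
      using dz[of n] z[of n] xM by auto
    moreover have "z n \<in> U"
      using z[of n] s(1)[of n] by (auto simp: U_def)
    ultimately show "\<exists>y\<in>U. y \<in> mball x r"
      by blast
  qed
  moreover have "y = x" if y: "y \<in> mtopology closure_of U" "y \<in> N" for y
  proof (rule ccontr)
    assume "y \<noteq> x"
    have yM: "y \<in> M"
      using y(1) by (simp add: metric_closure_of)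
    define \<delta> where "\<delta> = d x y / 2"
    have \<delta>: "\<delta> > 0"
      using \<open>y \<noteq> x\<close> xM yM by (simp add: \<delta>_def)
    then obtain K where K: "inverse (real (Suc K)) < \<delta> / 2"
      using reals_Archimedean[of "\<delta> / 2"] by auto
    have tail: "mball (z n) (s n) \<subseteq> mcball x \<delta>" if "K \<le> n" for n
    proof
      fix w
      assume "w \<in> mball (z n) (s n)"
      then have w: "w \<in> M" "d (z n) w < s n"
        by auto
      have "inverse (real (Suc n)) \<le> inverse (real (Suc K))"
        using that by simp
      moreover have "d x w \<le> d x (z n) + d (z n) w"
        using triangle xM w(1) z[of n] by blast
      ultimately have "d x w \<le> \<delta>"
        using w(2) dz[of n] s(2)[of n] K by linarith
      then show "w \<in> mcball x \<delta>"
        using xM w by simp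
    qed
    have "U \<subseteq> mcball x \<delta> \<union> (\<Union>n\<in>{..<K}. mcball (z n) (s n))"
    proof
      fix w
      assume "w \<in> U"
      then obtain n where "w \<in> mball (z n) (s n)"
        by (auto simp: U_def)
      then show "w \<in> mcball x \<delta> \<union> (\<Union>n\<in>{..<K}. mcball (z n) (s n))"
        using tail[of n] by (cases "K \<le> n") auto
    qed
    moreover have "closedin mtopology (mcball x \<delta> \<union> (\<Union>n\<in>{..<K}. mcball (z n) (s n)))"
      by (intro closedin_Un closedin_Union) auto
    ultimately have "y \<in> mcball x \<delta> \<union> (\<Union>n\<in>{..<K}. mcball (z n) (s n))"
      using y(1) closure_of_minimal by blast
    moreover have "y \<notin> mcball x \<delta>"
      using \<delta> by (auto simp: \<delta>_def)
    ultimately show False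
      using zN y(2) by blast
  qed
  ultimately show ?thesis
    using that by blast
qed

text \<open>
  Each point, and hence each finite set \<open>F\<close>, lies in the closure of an open set whose closure
  meets \<open>N\<close> only inside \<open>F\<close>. Countably many of these sets capture all finite sets, so \<open>N\<close> is a
  countable union of finite sets.
\<close>

lemma (in Metric_space) countable_nowhere_dense_if_K_Omega_Lindelof:
  assumes L: "K_Omega_Lindelof mtopology"
    and N: "closedin mtopology N" "mtopology interior_of N = {}"
  shows "countable N"
proof -
  have dense: "mtopology closure_of (M - N) = M"
    using N(2) closure_of_complement[of mtopology N] by simp
  have "\<exists>U. openin mtopology U \<and> x \<in> mtopology closure_of U \<and> mtopology closure_of U \<inter> N \<subseteq> {x}" if "x \<in> M" for x
  proof -
    have "x \<in> mtopology closure_of (M - N)"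
      using that dense by simp
    then obtain U where "openin mtopology U" "x \<in> mtopology closure_of U" "mtopology closure_of U \<inter> N \<subseteq> {x}"
      using open_set_touching_at_one_point[OF N(1)] by blast
    then show ?thesis
      by (intro exI conjI)
  qed
  then obtain V where V: "\<And>x. x \<in> M \<Longrightarrow> openin mtopology (V x)"
    "\<And>x. x \<in> M \<Longrightarrow> x \<in> mtopology closure_of V x"
    "\<And>x. x \<in> M \<Longrightarrow> mtopology closure_of V x \<inter> N \<subseteq> {x}"
    by metis
  define I where "I = {F. finite F \<and> F \<subseteq> M}"
  define W where "W F = (\<Union>x\<in>F. V x)" for F
  have cl: "mtopology closure_of W F = (\<Union>x\<in>F. mtopology closure_of V x)" if "finite F" for F
    unfolding W_def using that closure_of_Union[of "V ` F" mtopology] by auto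
  have "openin mtopology (W F)" if "F \<in> I" for F
    using that V(1) by (auto simp: W_def I_def)
  moreover have "\<exists>G\<in>I. F \<subseteq> mtopology closure_of W G" if "finite F" "F \<subseteq> M" for F
    using that V(2) by (auto simp: I_def cl intro!: bexI[of _ F])
  ultimately have "\<exists>J\<subseteq>I. countable J \<and> (\<forall>F. finite F \<and> F \<subseteq> topspace mtopology \<longrightarrow>
      (\<exists>G\<in>J. F \<subseteq> mtopology closure_of W G))"
    by (intro countable_subfamily_if_K_Omega_Lindelof[OF L]) simp_all
  then obtain J where J: "J \<subseteq> I" "countable J"
    "\<And>F. finite F \<Longrightarrow> F \<subseteq> M \<Longrightarrow> \<exists>G\<in>J. F \<subseteq> mtopology closure_of W G"
    by auto
  have "N \<subseteq> \<Union>J"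
  proof
    fix x
    assume x: "x \<in> N"
    then have "{x} \<subseteq> M"
      using closedin_subset[OF N(1)] by auto
    then obtain G where G: "G \<in> J" "x \<in> mtopology closure_of W G"
      using J(3)[of "{x}"] by auto
    then have "finite G" "G \<subseteq> M"
      using J(1) by (auto simp: I_def)
    then obtain y where "y \<in> G" "x \<in> mtopology closure_of V y" "y \<in> M"
      using G(2) cl by auto
    then have "x = y"
      using V(3)[of y] x by blast
    then show "x \<in> \<Union>J"
      using \<open>y \<in> G\<close> G(1) by blast
  qed
  moreover have "countable (\<Union>G\<in>J. G)"
    using J(1,2) by (intro countable_UN) (auto simp: I_def intro: countable_finite)
  ultimately show ?thesis
    by (auto intro: countable_subset)
qed

text \<open>
  The \<open>K_Omega\<close>-Lindelof property passes to the complement of a closed set. Adding the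
  neighbourhood \<open>G n\<close> of \<open>N\<close> to every \<open>U i\<close> gives a family on the whole space, and a countable
  subfamily of it treats correctly all finite sets that miss the closure of \<open>G n\<close>. Every finite
  set off \<open>N\<close> is of this kind for large \<open>n\<close>.
\<close>

lemma (in Metric_space) countable_subfamily_off_closed:
  assumes L: "K_Omega_Lindelof mtopology" and N: "closedin mtopology N"
    and U: "\<And>i. i \<in> I \<Longrightarrow> openin mtopology (U i)"
    and cover: "\<And>F. finite F \<Longrightarrow> F \<subseteq> M - N \<Longrightarrow> \<exists>i\<in>I. F \<subseteq> mtopology closure_of U i"
  shows "\<exists>J\<subseteq>I. countable J \<and>
    (\<forall>F. finite F \<and> F \<subseteq> M - N \<longrightarrow> (\<exists>i\<in>J. F \<subseteq> mtopology closure_of U i))"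
proof -
  define G where "G n = (\<Union>y\<in>N. mball y (inverse (real (Suc n))))" for n
  have openG: "openin mtopology (G n)" for n
    unfolding G_def by blast
  have NG: "N \<subseteq> G n" for n
    using closedin_subset[OF N] by (force simp: G_def)
  have "\<exists>J\<subseteq>I. countable J \<and> (\<forall>F. finite F \<and> F \<subseteq> M \<longrightarrow> (\<exists>i\<in>J. F \<subseteq> mtopology closure_of (U i \<union> G n)))" for n
  proof -
    have "\<exists>i\<in>I. F \<subseteq> mtopology closure_of (U i \<union> G n)" if F: "finite F" "F \<subseteq> M" for F
    proof -
      obtain i where i: "i \<in> I" "F - N \<subseteq> mtopology closure_of U i"
        using cover[of "F - N"] F by auto
      moreover have "N \<subseteq> mtopology closure_of G n"
        using NG[of n] closure_of_subset[OF openin_subset[OF openG[of n]]] by blast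
      ultimately show ?thesis
        by auto
    qed
    moreover have "openin mtopology (U i \<union> G n)" if "i \<in> I" for i
      using U[OF that] openG[of n] by blast
    ultimately have "\<exists>J\<subseteq>I. countable J \<and> (\<forall>F. finite F \<and> F \<subseteq> topspace mtopology \<longrightarrow>
        (\<exists>i\<in>J. F \<subseteq> mtopology closure_of (U i \<union> G n)))"
      by (intro countable_subfamily_if_K_Omega_Lindelof[OF L]) simp_all
    then show ?thesis
      by simp
  qed
  then obtain J where J: "\<And>n. J n \<subseteq> I" "\<And>n. countable (J n)"
    "\<And>n F. finite F \<Longrightarrow> F \<subseteq> M \<Longrightarrow> \<exists>i\<in>J n. F \<subseteq> mtopology closure_of (U i \<union> G n)"
    by metis
  have away: "\<exists>n. \<forall>m\<ge>n. x \<notin> mtopology closure_of G m" if x: "x \<in> M - N" for x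
  proof -
    have "openin mtopology (M - N)"
      using N by blast
    then obtain r where r: "r > 0" "mball x r \<subseteq> M - N"
      using x unfolding openin_mtopology by blast
    obtain n where n: "inverse (real (Suc n)) < r / 2"
      using reals_Archimedean[of "r / 2"] r by auto
    have "x \<notin> mtopology closure_of G m" if "m \<ge> n" for m
    proof
      assume "x \<in> mtopology closure_of G m"
      then obtain w where w: "w \<in> G m" "w \<in> mball x (r / 2)"
        using r(1) unfolding metric_closure_of by (auto simp del: in_mball dest!: spec[of _ "r / 2"])
      then obtain y where y: "y \<in> N" "w \<in> mball y (inverse (real (Suc m)))"
        by (auto simp: G_def)
      have "inverse (real (Suc m)) \<le> inverse (real (Suc n))"
        using that by simp
      moreover have "d x y \<le> d x w + d y w"
        using w(2) y(2) triangle[of x w y] by (auto simp: commute)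
      moreover have "d x w < r / 2" "d y w < inverse (real (Suc m))"
        using w(2) y(2) by simp_all
      ultimately have "d x y < r"
        using n by linarith
      then have "y \<in> mball x r"
        using w(2) y(2) by auto
      then show False
        using r(2) y(1) by blast
    qed
    then show ?thesis
      by blast
  qed
  have "\<exists>i\<in>\<Union>n. J n. F \<subseteq> mtopology closure_of U i" if F: "finite F" "F \<subseteq> M - N" for F
  proof -
    have "\<exists>n. \<forall>x\<in>F. \<forall>m\<ge>n. x \<notin> mtopology closure_of G m"
      using F
    proof (induction F rule: finite_induct)
      case (insert x F)
      then obtain n where n: "\<forall>y\<in>F. \<forall>m\<ge>n. y \<notin> mtopology closure_of G m"
        by auto
      obtain k where "\<forall>m\<ge>k. x \<notin> mtopology closure_of G m"
        using away[of x] insert.prems by auto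
      with n show ?case
        by (intro exI[of _ "max n k"]) auto
    qed auto
    then obtain n where n: "\<And>x. x \<in> F \<Longrightarrow> x \<notin> mtopology closure_of G n"
      by blast
    obtain i where i: "i \<in> J n" "F \<subseteq> mtopology closure_of (U i \<union> G n)"
      using J(3)[of F n] F by auto
    have "F \<subseteq> mtopology closure_of U i"
      using n i(2) by auto
    then show ?thesis
      using i(1) by blast
  qed
  then show ?thesis
    using J(1,2) by (intro exI[of _ "\<Union>n. J n"]) auto
qed

section \<open>Countable tightness at every function\<close>

text \<open>
  A quasicontinuous function has small oscillation on a dense open set, so the points of
  oscillation at least \<open>e\<close> form a closed nowhere dense set.
\<close>

lemma (in Metric_space) quasicontinuous_map_small_oscillation:
  assumes f: "quasicontinuous_map X mtopology f" and e: "e > 0"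
  obtains N where "closedin X N" "X interior_of N = {}"
    "\<And>x. x \<in> topspace X - N \<Longrightarrow> \<exists>S. openin X S \<and> x \<in> S \<and> (\<forall>y\<in>S. \<forall>z\<in>S. d (f y) (f z) < e)"
proof -
  define \<S> where "\<S> = {S. openin X S \<and> (\<forall>y\<in>S. \<forall>z\<in>S. d (f y) (f z) < e)}"
  have "openin X (\<Union>\<S>)"
    by (intro openin_Union) (auto simp: \<S>_def)
  then have "closedin X (topspace X - \<Union>\<S>)"
    by blast
  moreover have "X interior_of (topspace X - \<Union>\<S>) = {}"
  proof (rule ccontr)
    define O' where "O' = X interior_of (topspace X - \<Union>\<S>)"
    assume "X interior_of (topspace X - \<Union>\<S>) \<noteq> {}"
    then obtain x where x: "x \<in> O'"
      by (auto simp: O'_def)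
    have O': "openin X O'" "O' \<subseteq> topspace X - \<Union>\<S>"
      using interior_of_subset[of X "topspace X - \<Union>\<S>"] unfolding O'_def by simp_all
    then have fx: "f x \<in> M"
      using x f by (auto simp: quasicontinuous_map_def)
    then have "f x \<in> mball (f x) (e / 2)"
      using e by simp
    then obtain W where W: "openin X W" "W \<noteq> {}" "W \<subseteq> O'" "f ` W \<subseteq> mball (f x) (e / 2)"
      using quasicontinuous_mapE[OF f O'(1) x openin_mball] by metis
    have "d (f y) (f z) < e" if "y \<in> W" "z \<in> W" for y z
    proof -
      have "f y \<in> mball (f x) (e / 2)" "f z \<in> mball (f x) (e / 2)"
        using W(4) that by auto
      then show ?thesis
        using triangle[of "f y" "f x" "f z"] by (auto simp: commute)
    qed
    then have "W \<in> \<S>"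
      using W(1) by (simp add: \<S>_def)
    then show False
      using W(2,3) O'(2) by blast
  qed
  moreover have "\<exists>S. openin X S \<and> x \<in> S \<and> (\<forall>y\<in>S. \<forall>z\<in>S. d (f y) (f z) < e)"
    if "x \<in> topspace X - (topspace X - \<Union>\<S>)" for x
    using that by (auto simp: \<S>_def)
  ultimately show ?thesis
    using that by blast
qed

lemma interior_of_frontier_of_open:
  assumes "openin X U"
  shows "X interior_of (X frontier_of U) = {}"
proof -
  let ?W = "X interior_of (X frontier_of U)"
  have "?W \<subseteq> X closure_of U - U"
    using interior_of_subset[of X "X frontier_of U"] frontier_of_openin[OF assms] by simp
  moreover have "?W \<inter> X closure_of U = {} \<longleftrightarrow> ?W \<inter> U = {}"
    by (rule openin_Int_closure_of_eq_empty) simp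
  ultimately show ?thesis
    by blast
qed

text \<open>
  The set \<open>N\<close> of points where the oscillation of \<open>f\<close> is not small is countable. Off \<open>N\<close>, if \<open>g\<close>
  is close to \<open>f\<close> at \<open>x\<close>, then \<open>x\<close> lies in the closure of the open set \<open>U g\<close> on which \<open>g\<close> is
  close to \<open>f\<close>. Hence for each finite set \<open>T\<close> there are countably many \<open>g\<close>, all close to \<open>f\<close> on
  \<open>T\<close>, such that the closures of the \<open>U g\<close> capture the finite sets off \<open>N\<close>.

  A point in the closure of \<open>U g\<close> may be a frontier point, where \<open>g\<close> need not be close to \<open>f\<close>.
  But frontiers are nowhere dense, hence countable. So there is a countable set \<open>D\<close> containing
  \<open>N\<close> and all frontiers of the \<open>U g\<close> that were chosen for finite \<open>T \<subseteq> D\<close>. For an arbitrary finite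
  set \<open>F\<close> take \<open>T = F \<inter> D\<close>: on \<open>T\<close> the function \<open>g\<close> is close by choice, and the remaining
  points are in the closure of \<open>U g\<close> but not in its frontier.
\<close>

lemma (in Metric_space) countable_subset_close_on_finite_sets:
  fixes X :: "'b topology"
  assumes X: "metrizable_space X" and L: "K_Omega_Lindelof X"
    and A: "A \<subseteq> topspace (Qp X mtopology)" and fA: "f \<in> Qp X mtopology closure_of A"
    and e: "e > 0"
  shows "\<exists>B\<subseteq>A. countable B \<and>
    (\<forall>F. finite F \<and> F \<subseteq> topspace X \<longrightarrow> (\<exists>g\<in>B. \<forall>x\<in>F. d (f x) (g x) < e))"
proof -
  obtain S p where "Metric_space S p" and XS: "X = Metric_space.mtopology S p"
    using X unfolding metrizable_space_def by blast
  then interpret X: Metric_space S p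
    by simp
  have f: "quasicontinuous_map X mtopology f"
    using fA unfolding in_closure_of in_topspace_Qp by blast
  have quasi: "quasicontinuous_map X mtopology g" if "g \<in> A" for g
    using A that by (auto simp: in_topspace_Qp)
  have fM: "f x \<in> M" if "x \<in> topspace X" for x
    using f that by (auto simp: quasicontinuous_map_def)
  \<comment> \<open>one third each for the variation of \<open>f\<close> near a point, the variation
      of \<open>g\<close> on a suitable open set nearby, and the distance of \<open>f\<close>
      and \<open>g\<close> at the point\<close>
  define \<epsilon> where "\<epsilon> = e / 3"
  have \<epsilon>: "\<epsilon> > 0"
    using e by (simp add: \<epsilon>_def)
  obtain N where N: "closedin X N" "X interior_of N = {}"
    "\<And>x. x \<in> topspace X - N \<Longrightarrow> \<exists>S. openin X S \<and> x \<in> S \<and> (\<forall>y\<in>S. \<forall>z\<in>S. d (f y) (f z) < \<epsilon>)"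
    using quasicontinuous_map_small_oscillation[OF f \<epsilon>] by blast
  have nowhere_dense: "countable C" if "closedin X C" "X interior_of C = {}" for C
    using X.countable_nowhere_dense_if_K_Omega_Lindelof[of C] L that by (simp add: XS)
  define U where "U g = X interior_of {x \<in> topspace X. d (f x) (g x) < e}" for g
  have openU: "openin X (U g)" for g
    by (simp add: U_def)
  have U_close: "d (f x) (g x) < e" if "x \<in> U g" for x g
    using that interior_of_subset[of X "{x \<in> topspace X. d (f x) (g x) < e}"] unfolding U_def by blast
  define A' where "A' T = {g \<in> A. \<forall>x\<in>T. d (f x) (g x) < \<epsilon>}" for T
  have clU: "x \<in> X closure_of U g" if g: "g \<in> A" and x: "x \<in> topspace X - N" and close: "d (f x) (g x) < \<epsilon>" for x g
    unfolding in_closure_of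
  proof (intro conjI allI impI)
    show "x \<in> topspace X"
      using x by blast
    fix T
    assume T: "x \<in> T \<and> openin X T"
    obtain O' where O': "openin X O'" "x \<in> O'" "\<forall>y\<in>O'. \<forall>z\<in>O'. d (f y) (f z) < \<epsilon>"
      using N(3)[OF x] by blast
    have gx: "g x \<in> M"
      using quasi[OF g] x by (auto simp: quasicontinuous_map_def)
    have TO: "openin X (T \<inter> O')" "x \<in> T \<inter> O'"
      using T O' by auto
    have "g x \<in> mball (g x) \<epsilon>"
      using gx \<epsilon> by simp
    then obtain W where W: "openin X W" "W \<noteq> {}" "W \<subseteq> T \<inter> O'" "g ` W \<subseteq> mball (g x) \<epsilon>"
      using quasicontinuous_mapE[OF quasi[OF g] TO openin_mball] by metis
    have "d (f w) (g w) < e" if w: "w \<in> W" for w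
    proof -
      have wX: "w \<in> topspace X"
        using W(1) w openin_subset by blast
      have gw: "g w \<in> M" "d (g x) (g w) < \<epsilon>"
        using W(4) w by auto
      have "d (f w) (f x) < \<epsilon>"
        using O'(2,3) W(3) w by blast
      moreover have "d (f w) (g w) \<le> d (f w) (g x) + d (g x) (g w)"
        using triangle fM[OF wX] gx gw(1) by blast
      moreover have "d (f w) (g x) \<le> d (f w) (f x) + d (f x) (g x)"
        using triangle fM[OF wX] gx fM[of x] x by blast
      ultimately show ?thesis
        using gw(2) close unfolding \<epsilon>_def by linarith
    qed
    then have "W \<subseteq> {x \<in> topspace X. d (f x) (g x) < e}"
      using openin_subset[OF W(1)] by blast
    then have "W \<subseteq> U g"
      unfolding U_def using W(1) interior_of_maximal by blast
    then show "\<exists>y. y \<in> U g \<and> y \<in> T"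
      using W(2,3) by blast
  qed
  have "\<exists>J\<subseteq>A' T. countable J \<and>
      (\<forall>F. finite F \<and> F \<subseteq> topspace X - N \<longrightarrow> (\<exists>g\<in>J. F \<subseteq> X closure_of U g))"
    if T: "finite T" "T \<subseteq> topspace X" for T
  proof -
    have "\<exists>g\<in>A' T. F \<subseteq> X closure_of U g" if F: "finite F" "F \<subseteq> topspace X - N" for F
    proof -
      have TF: "finite (T \<union> F)" "T \<union> F \<subseteq> topspace X"
        using T F by auto
      obtain g where g: "g \<in> A" "\<forall>x\<in>T \<union> F. d (f x) (g x) < \<epsilon>"
        using fA[unfolded in_closure_of_Qp[OF A], THEN conjunct2, rule_format, of "T \<union> F" \<epsilon>] TF \<epsilon> by auto
      then have "F \<subseteq> X closure_of U g"
        using clU[OF g(1)] F(2) by blast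
      with g show ?thesis
        by (auto simp: A'_def)
    qed
    then have "\<exists>J\<subseteq>A' T. countable J \<and>
      (\<forall>F. finite F \<and> F \<subseteq> S - N \<longrightarrow> (\<exists>g\<in>J. F \<subseteq> X.mtopology closure_of U g))"
      using L N(1) openU unfolding XS by (intro X.countable_subfamily_off_closed) simp_all
    then show ?thesis
      by (simp add: XS)
  qed
  then obtain J where J: "\<And>T. finite T \<Longrightarrow> T \<subseteq> topspace X \<Longrightarrow> J T \<subseteq> A' T"
    "\<And>T. finite T \<Longrightarrow> T \<subseteq> topspace X \<Longrightarrow> countable (J T)"
    "\<And>T F. finite T \<Longrightarrow> T \<subseteq> topspace X \<Longrightarrow> finite F \<Longrightarrow> F \<subseteq> topspace X - N \<Longrightarrow>
        \<exists>g\<in>J T. F \<subseteq> X closure_of U g"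
    by metis
  define step where "step K = K \<union> (\<Union>T\<in>{T. finite T \<and> T \<subseteq> K}. \<Union>g\<in>J T. X frontier_of U g)" for K
  define K where "K n = (step ^^ n) N" for n
  have K_Suc: "K (Suc n) = step (K n)" for n
    by (simp add: K_def)
  have K: "K n \<subseteq> topspace X \<and> countable (K n)" for n
  proof (induction n)
    case 0
    then show ?case
      using nowhere_dense[OF N(1,2)] closedin_subset[OF N(1)] by (simp add: K_def)
  next
    case (Suc n)
    have "countable (X frontier_of U g)" for g
      by (intro nowhere_dense closedin_frontier_of interior_of_frontier_of_open openU)
    then have "countable (step (K n))"
      unfolding step_def using Suc J(2)
      by (intro countable_Un countable_UN countable_Collect_finite_subset) auto
    moreover have "step (K n) \<subseteq> topspace X"
      unfolding step_def using Suc frontier_of_subset_topspace[of X] by blast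
    ultimately show ?case
      by (simp add: K_Suc)
  qed
  have K_mono: "K m \<subseteq> K n" if "m \<le> n" for m n
    by (rule lift_Suc_mono_le[OF _ that]) (auto simp: K_Suc step_def)
  define D where "D = (\<Union>n. K n)"
  have D: "D \<subseteq> topspace X" "countable D" "N \<subseteq> D"
    using K K_def[of 0] by (auto simp: D_def)
  have D_closed: "X frontier_of U g \<subseteq> D" if T: "finite T" "T \<subseteq> D" and g: "g \<in> J T" for T g
  proof -
    have "\<exists>n. T \<subseteq> K n"
      using T
    proof (induction T rule: finite_induct)
      case (insert x T)
      then obtain m n where "x \<in> K m" "T \<subseteq> K n"
        by (auto simp: D_def)
      then have "insert x T \<subseteq> K (max m n)"
        using K_mono[of m "max m n"] K_mono[of n "max m n"] by auto
      then show ?case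
        by blast
    qed auto
    then obtain n where "T \<subseteq> K n"
      by blast
    then have "X frontier_of U g \<subseteq> K (Suc n)"
      unfolding K_Suc step_def using T(1) g by blast
    then show ?thesis
      by (auto simp: D_def)
  qed
  define B where "B = (\<Union>T\<in>{T. finite T \<and> T \<subseteq> D}. J T)"
  have "countable B"
    unfolding B_def using D J(2)
    by (intro countable_UN countable_Collect_finite_subset) auto
  moreover have "B \<subseteq> A"
    using J(1) D(1) by (force simp: B_def A'_def)
  moreover have "\<exists>g\<in>B. \<forall>x\<in>F. d (f x) (g x) < e" if F: "finite F" "F \<subseteq> topspace X" for F
  proof -
    define T where "T = F \<inter> D"
    have T: "finite T" "T \<subseteq> D" "T \<subseteq> topspace X"
      using F D(1) by (auto simp: T_def)
    obtain g where g: "g \<in> J T" "F - N \<subseteq> X closure_of U g"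
      using J(3)[OF T(1,3), of "F - N"] F by auto
    have "d (f x) (g x) < e" if x: "x \<in> F" for x
    proof (cases "x \<in> D")
      case True
      then have "d (f x) (g x) < \<epsilon>"
        using J(1)[OF T(1,3)] g(1) x by (auto simp: A'_def T_def)
      then show ?thesis
        using e by (simp add: \<epsilon>_def)
    next
      case False
      then have "x \<in> X closure_of U g" "x \<notin> X frontier_of U g"
        using g(2) D(3) D_closed[OF T(1,2) g(1)] x by auto
      then have "x \<in> U g"
        using openU[of g] by (simp add: frontier_of_def interior_of_openin)
      then show ?thesis
        by (rule U_close)
    qed
    moreover have "g \<in> B"
      using g(1) T by (auto simp: B_def)
    ultimately show ?thesis
      by blast
  qed
  ultimately show ?thesis
    by (intro exI[of _ B]) simp
qed

theorem countable_tightness_Qp_if_K_Omega_Lindelof: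
  assumes X: "metrizable_space X" and Y: "metrizable_space Y" and L: "K_Omega_Lindelof X"
  shows "countable_tightness (Qp X Y)"
  unfolding countable_tightness_def countable_tightness_at_def
proof (intro ballI allI impI)
  fix f A
  assume f: "f \<in> topspace (Qp X Y)" and A: "A \<subseteq> topspace (Qp X Y)" and fA: "f \<in> Qp X Y closure_of A"
  obtain M d where "Metric_space M d" and YM: "Y = Metric_space.mtopology M d"
    using Y unfolding metrizable_space_def by blast
  then interpret Metric_space M d
    by simp
  have "\<exists>B\<subseteq>A. countable B \<and> (\<forall>F. finite F \<and> F \<subseteq> topspace X \<longrightarrow>
      (\<exists>g\<in>B. \<forall>x\<in>F. d (f x) (g x) < inverse (real (Suc n))))" for n
    using countable_subset_close_on_finite_sets[OF X L A[unfolded YM] fA[unfolded YM]] by simp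
  then obtain B where B: "\<And>n. B n \<subseteq> A" "\<And>n. countable (B n)"
    "\<And>n F. finite F \<Longrightarrow> F \<subseteq> topspace X \<Longrightarrow> \<exists>g\<in>B n. \<forall>x\<in>F. d (f x) (g x) < inverse (real (Suc n))"
    by metis
  have "\<exists>g\<in>\<Union>n. B n. \<forall>x\<in>F. d (f x) (g x) < e" if F: "finite F" "F \<subseteq> topspace X" and e: "e > 0" for F e
  proof -
    obtain n where n: "inverse (real (Suc n)) < e"
      using reals_Archimedean[OF e] by blast
    obtain g where g: "g \<in> B n" "\<forall>x\<in>F. d (f x) (g x) < inverse (real (Suc n))"
      using B(3)[OF F] by blast
    then have "\<forall>x\<in>F. d (f x) (g x) < e"
      using n by fastforce
    with g(1) show ?thesis
      by blast
  qed
  moreover have BA: "(\<Union>n. B n) \<subseteq> A"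
    using B(1) by blast
  then have BQ: "(\<Union>n. B n) \<subseteq> topspace (Qp X mtopology)"
    using A unfolding YM by blast
  ultimately have "f \<in> Qp X Y closure_of (\<Union>n. B n)"
    unfolding YM in_closure_of_Qp[OF BQ] using f unfolding YM by blast
  then show "\<exists>B\<subseteq>A. countable B \<and> f \<in> Qp X Y closure_of B"
    using BA B(2) by (intro exI[of _ "\<Union>n. B n"]) auto
qed

section \<open>The equivalence\<close>

lemma nontrivial_metrizable_discrete_topology:
  assumes "\<exists>u v :: 'b. u \<noteq> v"
  shows "nontrivial_metrizable (discrete_topology (UNIV :: 'b set))"
  using assms by (simp add: nontrivial_metrizable_def)

theorem theorem6p4:
  fixes X :: "'a topology"
  assumes "metrizable_space X"
    and "\<exists>u v :: 'b. u \<noteq> v"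
    and "\<exists>u v :: 'c. u \<noteq> v"
  shows "((\<forall>Y :: 'b topology. nontrivial_metrizable Y \<longrightarrow> countable_tightness (Qp X Y))
            \<longleftrightarrow> K_Omega_Lindelof X) \<and>
         ((\<exists>Y :: 'c topology. nontrivial_metrizable Y \<and>
              (\<exists>f \<in> topspace (Qp X Y). countable_tightness_at f (Qp X Y)))
            \<longleftrightarrow> K_Omega_Lindelof X) \<and>
         ((\<exists>f \<in> topspace (Qp X (euclidean :: real topology)).
              countable_tightness_at f (Qp X (euclidean :: real topology)))
            \<longleftrightarrow> K_Omega_Lindelof X)"
proof (intro conjI)
  have euclidean: "nontrivial_metrizable (euclidean :: real topology)"
    unfolding nontrivial_metrizable_def
    by (intro conjI metrizable_space_euclidean bexI[of _ "0::real"] bexI[of _ "1::real"]) simp_all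
  note to = K_Omega_Lindelof_if_countable_tightness_at[OF assms(1)]
  have tight: "countable_tightness (Qp X Y)" if "K_Omega_Lindelof X" "nontrivial_metrizable Y"
    for Y :: "'y topology"
    using that(2) unfolding nontrivial_metrizable_def
    by (intro countable_tightness_Qp_if_K_Omega_Lindelof[OF assms(1) _ that(1)]) blast
  have ex_point: "\<exists>f\<in>topspace (Qp X Y). countable_tightness_at f (Qp X Y)"
    if tight_Y: "countable_tightness (Qp X Y)" and Y: "nontrivial_metrizable Y" for Y :: "'y topology"
  proof -
    obtain y where "y \<in> topspace Y"
      using Y unfolding nontrivial_metrizable_def by blast
    then show ?thesis
      using tight_Y constant_in_topspace_Qp[of y Y X] unfolding countable_tightness_def by blast
  qed
  show "(\<forall>Y :: 'b topology. nontrivial_metrizable Y \<longrightarrow> countable_tightness (Qp X Y))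
      \<longleftrightarrow> K_Omega_Lindelof X"
  proof
    let ?Y = "discrete_topology (UNIV :: 'b set)"
    have Y: "nontrivial_metrizable ?Y"
      by (rule nontrivial_metrizable_discrete_topology[OF assms(2)])
    assume "\<forall>Y :: 'b topology. nontrivial_metrizable Y \<longrightarrow> countable_tightness (Qp X Y)"
    then obtain f where "f \<in> topspace (Qp X ?Y)" "countable_tightness_at f (Qp X ?Y)"
      using ex_point[OF _ Y] Y by blast
    then show "K_Omega_Lindelof X"
      by (rule to[OF Y])
  qed (blast intro: tight)
  show "(\<exists>Y :: 'c topology. nontrivial_metrizable Y \<and>
        (\<exists>f \<in> topspace (Qp X Y). countable_tightness_at f (Qp X Y))) \<longleftrightarrow> K_Omega_Lindelof X"
  proof
    assume "K_Omega_Lindelof X"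
    moreover have "nontrivial_metrizable (discrete_topology (UNIV :: 'c set))"
      by (rule nontrivial_metrizable_discrete_topology[OF assms(3)])
    ultimately show "\<exists>Y :: 'c topology. nontrivial_metrizable Y \<and>
        (\<exists>f \<in> topspace (Qp X Y). countable_tightness_at f (Qp X Y))"
      using ex_point tight by blast
  qed (blast intro: to)
  show "(\<exists>f \<in> topspace (Qp X (euclidean :: real topology)).
        countable_tightness_at f (Qp X (euclidean :: real topology))) \<longleftrightarrow> K_Omega_Lindelof X"
    using to[OF euclidean] tight[OF _ euclidean] ex_point[OF _ euclidean] by blast
qed

end
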